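(* Let $X$ be an infinite-dimensional complex Hilbert space and let $A\in\mathcal{B}(X)$ be generalized Drazin invertible. Then, for $B\in\mathcal{B}(X)$, the following statements are equivalent: (i) $B$ is the weak group inverse of $A$, i.e. $B=A^{\otimes}$; (ii) $A^{\mathrm{cEP}}AB=B$ and $AB=A^{\mathrm{cEP}}A$; (iii) $BAB=B$, $AB=A^{\mathrm{cEP}}A$ and $BA^{\mathrm{cEP}}=A^{\mathrm{cEP}}A^{\mathrm{cEP}}$; (iv) $BAB=B$, $AB=A^{\mathrm{cEP}}A$ and $BA^d=(A^d)^2$.
   Context: $\mathcal{B}(X)$ is the set of bounded linear operators on $X$; $R(\cdot)$ denotes range; $P_L$ is the orthogonal projector onto a closed subspace $L$. $A\in\mathcal{B}(X)$ is generalized Drazin invertible if there is a (necessarily unique) $A^d\in\mathcal{B}(X)$ with $AA^d=A^dA$, $A^dAA^d=A^d$ and $A-A^2A^d$ quasinilpotent. The core-EP inverse $A^{\mathrm{cEP}}$ of such $A$ is the unique (it exists) operator $B\in\mathcal{B}(X)$ with $AB=P_{R(A^d)}$ and $R(B)\subseteq R(A^d)$. The weak group inverse of $A$ is $A^{\otimes}=(A^{\mathrm{cEP}})^2A$. *)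

theory Defs
  imports "HOL-Analysis.Analysis"
begin

text \<open>
  Complex Hilbert spaces, as complete real inner product spaces that carry a compatible complex
  scalar multiplication and a sesquilinear form (linear in the first argument). By
  \<open>inner_eq_Re_cinner\<close> the norm is the one induced by the form, and the form is positive definite.
\<close>

class complex_hilbert_space = real_inner + complete_space +
  fixes scaleC :: "complex \<Rightarrow> 'a \<Rightarrow> 'a" (infixr \<open>*\<^sub>C\<close> 75)
    and cinner :: "'a \<Rightarrow> 'a \<Rightarrow> complex"
  assumes scaleC_add_right: "c *\<^sub>C (x + y) = c *\<^sub>C x + c *\<^sub>C y"
    and scaleC_add_left: "(c + d) *\<^sub>C x = c *\<^sub>C x + d *\<^sub>C x"
    and scaleC_scaleC: "c *\<^sub>C (d *\<^sub>C x) = (c * d) *\<^sub>C x"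
    and scaleC_one: "1 *\<^sub>C x = x"
    and scaleR_scaleC: "r *\<^sub>R x = complex_of_real r *\<^sub>C x"
    and cinner_commute: "cinner x y = cnj (cinner y x)"
    and cinner_add_left: "cinner (x + y) z = cinner x z + cinner y z"
    and cinner_scaleC_left: "cinner (c *\<^sub>C x) y = c * cinner x y"
    and inner_eq_Re_cinner: "inner x y = Re (cinner x y)"

lemma vector_space_scaleC: "vector_space (scaleC :: complex \<Rightarrow> 'a \<Rightarrow> 'a::complex_hilbert_space)"
  by unfold_locales
    (simp_all add: scaleC_add_right scaleC_add_left scaleC_scaleC scaleC_one)

lemma cinner_self_eq_norm: "cinner x x = complex_of_real ((norm x)\<^sup>2)"
  for x :: "'a::complex_hilbert_space"
proof (rule complex_eqI)
  show "Re (cinner x x) = Re (complex_of_real ((norm x)\<^sup>2))"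
    by (simp add: power2_norm_eq_inner inner_eq_Re_cinner)
  have "Im (cinner x x) = - Im (cinner x x)"
    by (subst cinner_commute) simp
  then show "Im (cinner x x) = Im (complex_of_real ((norm x)\<^sup>2))"
    by simp
qed

abbreviation cspan :: "'a::complex_hilbert_space set \<Rightarrow> 'a set"
  where "cspan \<equiv> module.span scaleC"

definition bounded_clinear ::
    "('a::complex_hilbert_space \<Rightarrow> 'b::complex_hilbert_space) \<Rightarrow> bool"
  where "bounded_clinear f \<longleftrightarrow> bounded_linear f \<and> (\<forall>c x. f (c *\<^sub>C x) = c *\<^sub>C f x)"

definition op_spectrum :: "('a::complex_hilbert_space \<Rightarrow> 'a) \<Rightarrow> complex set"
  where "op_spectrum T =
    {z. \<not> (\<exists>S. bounded_clinear S \<and>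
            S \<circ> (\<lambda>x. T x - z *\<^sub>C x) = id \<and> (\<lambda>x. T x - z *\<^sub>C x) \<circ> S = id)}"

definition quasinilpotent :: "('a::complex_hilbert_space \<Rightarrow> 'a) \<Rightarrow> bool"
  where "quasinilpotent T \<longleftrightarrow> op_spectrum T = {0}"

definition is_gen_drazin_inverse ::
    "('a::complex_hilbert_space \<Rightarrow> 'a) \<Rightarrow> ('a \<Rightarrow> 'a) \<Rightarrow> bool"
  where "is_gen_drazin_inverse A D \<longleftrightarrow>
    bounded_clinear D \<and> A \<circ> D = D \<circ> A \<and> D \<circ> A \<circ> D = D \<and>
    quasinilpotent (\<lambda>x. A x - A (A (D x)))"

definition gen_drazin_invertible :: "('a::complex_hilbert_space \<Rightarrow> 'a) \<Rightarrow> bool"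
  where "gen_drazin_invertible A \<longleftrightarrow> (\<exists>D. is_gen_drazin_inverse A D)"

definition gen_drazin_inverse :: "('a::complex_hilbert_space \<Rightarrow> 'a) \<Rightarrow> 'a \<Rightarrow> 'a"
  where "gen_drazin_inverse A = (THE D. is_gen_drazin_inverse A D)"

text \<open>Only meaningful for closed complex subspaces, such as the range of a generalized Drazin inverse.\<close>

definition orth_proj :: "'a::complex_hilbert_space set \<Rightarrow> 'a \<Rightarrow> 'a"
  where "orth_proj L x = (THE y. y \<in> L \<and> (\<forall>z\<in>L. cinner (x - y) z = 0))"

definition core_EP_inverse :: "('a::complex_hilbert_space \<Rightarrow> 'a) \<Rightarrow> 'a \<Rightarrow> 'a"
  where "core_EP_inverse A =
    (THE B. bounded_clinear B \<and>
       A \<circ> B = orth_proj (range (gen_drazin_inverse A)) \<and>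
       range B \<subseteq> range (gen_drazin_inverse A))"

definition weak_group_inverse :: "('a::complex_hilbert_space \<Rightarrow> 'a) \<Rightarrow> 'a \<Rightarrow> 'a"
  where "weak_group_inverse A = core_EP_inverse A \<circ> core_EP_inverse A \<circ> A"

end

theory Submission
  imports Defs "HOL-Complex_Analysis.Conformal_Mappings"
begin

text \<open>
  Let \<open>D\<close> be a generalized Drazin inverse of \<open>A\<close> and \<open>P\<close> the orthogonal projector onto the range
  of \<open>D\<close>. Since \<open>A D\<close> is the identity on that range, the core-EP inverse is \<open>C = D P\<close>, and all the
  equivalences are algebraic consequences of \<open>A C = P\<close>, \<open>P C = C\<close>, \<open>C P = C\<close> and \<open>C D = D D\<close>.

  Uniqueness of \<open>D\<close> is a spectral separation argument. If \<open>D\<close> and \<open>E\<close> are two generalized Drazin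
  inverses, \<open>p = A D\<close>, \<open>q = A E\<close> and \<open>Q = A - A A E\<close>, then \<open>T = p (1 - q)\<close> satisfies \<open>D T Q = T\<close> and
  \<open>T = (1 - q) p\<close> satisfies \<open>Q T D = T\<close>. As \<open>Q\<close> is quasinilpotent, in either case the composition of
  \<open>T\<close> with the resolvent of \<open>Q\<close> is bounded near 0, hence entire, and vanishes at infinity, so that
  \<open>T = 0\<close> by Liouville's theorem. Therefore \<open>p = q\<close>, which gives \<open>D = E\<close>.
\<close>

section \<open>Norm and sesquilinear form of a complex Hilbert space\<close>

interpretation scaleC: vector_space "scaleC :: complex \<Rightarrow> 'a \<Rightarrow> 'a::complex_hilbert_space"
  by (rule vector_space_scaleC)

lemma cinner_zero_left: "cinner 0 x = 0"
  for x :: "'a::complex_hilbert_space"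
  using cinner_add_left[of 0 0 x] by simp

lemma cinner_scaleC_right: "cinner x (c *\<^sub>C y) = cnj c * cinner x y"
  for x y :: "'a::complex_hilbert_space"
  by (metis cinner_scaleC_left cinner_commute complex_cnj_mult)

lemma cinner_eq_0_iff: "cinner x x = 0 \<longleftrightarrow> x = 0"
  for x :: "'a::complex_hilbert_space"
  by (simp add: cinner_self_eq_norm)

lemma norm_scaleC: "norm (c *\<^sub>C x) = cmod c * norm x"
  for x :: "'a::complex_hilbert_space"
proof -
  have "complex_of_real ((norm (c *\<^sub>C x))\<^sup>2) = c * cnj c * complex_of_real ((norm x)\<^sup>2)"
    by (simp only: cinner_self_eq_norm[symmetric] cinner_scaleC_left cinner_scaleC_right mult_ac)
  also have "\<dots> = complex_of_real ((cmod c * norm x)\<^sup>2)"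
    by (simp only: power_mult_distrib of_real_mult complex_norm_square)
  finally have "(norm (c *\<^sub>C x))\<^sup>2 = (cmod c * norm x)\<^sup>2"
    using of_real_eq_iff by blast
  then show ?thesis
    by (simp add: power2_eq_iff_nonneg)
qed

text \<open>Rotating \<open>x\<close> by a phase makes the form real and nonnegative, which reduces
  the claim to the real Cauchy-Schwarz inequality.\<close>

lemma cmod_cinner_le: "cmod (cinner x y) \<le> norm x * norm y"
  for x y :: "'a::complex_hilbert_space"
proof -
  \<comment> \<open>If the form vanishes then \<open>c = 0\<close>, since \<open>sgn 0 = 0\<close>.
    Otherwise \<open>c\<close> has modulus 1. Both cases satisfy the next equation and make the norm
    of \<open>c\<close> at most 1.\<close>
  define c where "c = cnj (sgn (cinner x y))"
  have c: "c * cinner x y = cmod (cinner x y)"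
    by (simp add: c_def sgn_eq complex_norm_square[symmetric] field_simps power2_eq_square)
  have "cmod (cinner x y) = inner (c *\<^sub>C x) y"
    by (simp add: inner_eq_Re_cinner cinner_scaleC_left c)
  also have "\<dots> \<le> norm (c *\<^sub>C x) * norm y"
    by (rule norm_cauchy_schwarz)
  also have "\<dots> \<le> norm x * norm y"
    by (simp add: norm_scaleC c_def norm_sgn)
  finally show ?thesis .
qed

text \<open>These functionals separate points, so they turn vanishing statements about vectors into
  scalar ones, to which complex analysis applies.\<close>

lemma bounded_linear_cinner_left: "bounded_linear (\<lambda>x. cinner x y)"
  by (rule bounded_linear_intro[of _ "norm y"])
    (simp_all add: cinner_add_left cinner_scaleC_left scaleR_scaleC cmod_cinner_le scaleR_conv_of_real)

lemma bounded_clinear_compose: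
  "bounded_clinear f \<Longrightarrow> bounded_clinear g \<Longrightarrow> bounded_clinear (\<lambda>x. f (g x))"
  by (simp add: bounded_clinear_def bounded_linear_compose)

section \<open>Orthogonal projection onto a closed subspace\<close>

text \<open>A sequence in \<open>L\<close> whose squared distances to \<open>x\<close> approach the
  infimum is Cauchy by the parallelogram law; completeness and closedness then give the
  minimizer.\<close>

lemma closest_point_exists:
  fixes L :: "'a::{real_inner, complete_space} set"
  assumes L: "subspace L" "closed L"
  obtains y where "y \<in> L" "\<And>z. z \<in> L \<Longrightarrow> norm (x - y) \<le> norm (x - z)"
proof -
  define q where "q = (INF z\<in>L. (norm (x - z))\<^sup>2)"
  have ne: "L \<noteq> {}" using L subspace_0 by blast
  have bdd: "bdd_below ((\<lambda>z. (norm (x - z))\<^sup>2) ` L)"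
    by (rule bdd_belowI[of _ 0]) auto
  have q: "q \<le> (norm (x - z))\<^sup>2" if "z \<in> L" for z
    unfolding q_def using bdd that by (rule cINF_lower)
  have "\<exists>y\<in>L. (norm (x - y))\<^sup>2 < q + 1 / real (Suc n)" for n
    using ne bdd by (subst cINF_less_iff[symmetric]) (auto simp: q_def)
  then obtain Y where Y: "\<And>n. Y n \<in> L" "\<And>n. (norm (x - Y n))\<^sup>2 < q + 1 / real (Suc n)"
    by metis
  \<comment> \<open>Parallelogram law for \<open>x - Y m\<close> and \<open>x - Y n\<close>: the
    midpoint of \<open>Y m\<close> and \<open>Y n\<close> lies in \<open>L\<close>, so its squared
    distance is at least \<open>q\<close>, and the four copies of \<open>q\<close> cancel.\<close>
  have diff: "(norm (Y m - Y n))\<^sup>2 \<le> 2 / real (Suc m) + 2 / real (Suc n)" for m n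
  proof -
    have mid: "(1/2) *\<^sub>R (Y m + Y n) \<in> L"
      using L Y by (simp add: subspace_add subspace_scale)
    have "(norm (Y m - Y n))\<^sup>2
        = 2 * (norm (x - Y m))\<^sup>2 + 2 * (norm (x - Y n))\<^sup>2 - 4 * (norm (x - (1/2) *\<^sub>R (Y m + Y n)))\<^sup>2"
      by (simp add: power2_norm_eq_inner inner_diff_left inner_diff_right inner_add_left
          inner_add_right inner_commute algebra_simps)
    also have "\<dots> \<le> 2 / real (Suc m) + 2 / real (Suc n)"
      using q[OF mid] Y(2)[of m] Y(2)[of n] unfolding divide_inverse by linarith
    finally show ?thesis .
  qed
  have "Cauchy Y"
  proof (rule metric_CauchyI)
    fix e :: real assume e: "0 < e"
    then obtain M where "1 / real (Suc M) < e\<^sup>2 / 4"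
      using nat_approx_posE[of "e\<^sup>2 / 4"] by auto
    then have M: "2 / real (Suc M) + 2 / real (Suc M) < e\<^sup>2"
      by simp
    show "\<exists>M. \<forall>m\<ge>M. \<forall>n\<ge>M. dist (Y m) (Y n) < e"
    proof (intro exI allI impI)
      fix m n assume "M \<le> m" "M \<le> n"
      then have "2 / real (Suc m) \<le> 2 / real (Suc M)" "2 / real (Suc n) \<le> 2 / real (Suc M)"
        by (auto intro!: divide_left_mono)
      then have "(norm (Y m - Y n))\<^sup>2 < e\<^sup>2"
        using diff[of m n] M by linarith
      then show "dist (Y m) (Y n) < e"
        using e by (simp add: dist_norm power2_less_imp_less)
    qed
  qed
  then obtain y where lim: "Y \<longlonglongrightarrow> y"
    using Cauchy_convergent convergent_def by blast
  have "y \<in> L"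
    using L(2) Y(1) lim by (rule closed_sequentially)
  moreover have "norm (x - y) \<le> norm (x - z)" if "z \<in> L" for z
  proof -
    have "(\<lambda>n. (norm (x - Y n))\<^sup>2) \<longlonglongrightarrow> (norm (x - y))\<^sup>2"
      by (intro tendsto_intros lim)
    moreover have "(\<lambda>n. q + 1 / real (Suc n)) \<longlonglongrightarrow> q + 0"
      by (intro tendsto_intros LIMSEQ_Suc[OF lim_1_over_n])
    ultimately have "(norm (x - y))\<^sup>2 \<le> q + 0"
      using Y(2) by (intro LIMSEQ_le) (auto intro: less_imp_le)
    with q[OF that] show ?thesis
      by (simp add: power2_le_imp_le)
  qed
  ultimately show thesis by (rule that)
qed

text \<open>First-order condition at the closest point: moving from \<open>y\<close> along
  \<open>z\<close> inside \<open>L\<close> cannot reduce the distance to \<open>x\<close>.\<close>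

lemma orthogonal_decomposition:
  fixes L :: "'a::{real_inner, complete_space} set"
  assumes L: "subspace L" "closed L"
  obtains y where "y \<in> L" "\<And>z. z \<in> L \<Longrightarrow> inner (x - y) z = 0"
proof -
  obtain y where y: "y \<in> L" "\<And>z. z \<in> L \<Longrightarrow> norm (x - y) \<le> norm (x - z)"
    using closest_point_exists[OF L] by blast
  have "inner (x - y) z = 0" if z: "z \<in> L" for z
  proof (cases "z = 0")
    case False
    \<comment> \<open>The minimizer over real \<open>t\<close> of the squared norm of
      \<open>(x - y) - t *\<^sub>R z\<close>; it would lower that norm strictly if the inner product
      were nonzero.\<close>
    define t where "t = inner (x - y) z / inner z z"
    have "y + t *\<^sub>R z \<in> L"
      using L y z by (simp add: subspace_add subspace_scale)
    then have "(norm (x - y))\<^sup>2 \<le> (norm (x - (y + t *\<^sub>R z)))\<^sup>2"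
      using y(2) by (simp add: power_mono)
    also have "\<dots> = (norm ((x - y) - t *\<^sub>R z))\<^sup>2"
      by (simp add: algebra_simps)
    also have "\<dots> = (norm (x - y))\<^sup>2 - 2 * t * inner (x - y) z + t * t * inner z z"
      by (simp only: power2_norm_eq_inner inner_diff_left inner_diff_right) (simp add: inner_commute algebra_simps)
    also have "t * t * inner z z = t * inner (x - y) z"
      using False by (simp add: t_def)
    finally have "t * inner (x - y) z \<le> 0"
      by simp
    moreover have "t * inner (x - y) z = (inner (x - y) z)\<^sup>2 / inner z z"
      by (simp add: t_def power2_eq_square)
    ultimately have "(inner (x - y) z)\<^sup>2 / inner z z \<le> 0" by simp
    moreover have "0 < inner z z" using False by simp
    ultimately have "(inner (x - y) z)\<^sup>2 \<le> 0"
      by (simp add: divide_le_0_iff)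
    then show ?thesis by simp
  qed simp
  with y(1) show thesis by (rule that)
qed

text \<open>A complex subspace is also a real one, so the real decomposition applies; real
  orthogonality to all of \<open>L\<close> becomes complex orthogonality because \<open>L\<close> is
  stable under multiplication by \<open>\<i>\<close>.\<close>

lemma orth_proj:
  fixes L :: "'a::complex_hilbert_space set"
  assumes L: "scaleC.subspace L" "closed L"
  shows orth_proj_eqI: "\<And>x y. y \<in> L \<Longrightarrow> (\<And>z. z \<in> L \<Longrightarrow> cinner (x - y) z = 0) \<Longrightarrow> orth_proj L x = y"
    and orth_proj_mem: "\<And>x. orth_proj L x \<in> L"
    and orth_proj_orth: "\<And>x z. z \<in> L \<Longrightarrow> cinner (x - orth_proj L x) z = 0"
proof -
  have sub: "subspace L"
    using L(1) by (simp add: subspace_def scaleC.subspace_def scaleR_scaleC)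
  have unique: "y = y'" if y: "y \<in> L" "\<forall>z\<in>L. cinner (x - y) z = 0"
    and y': "y' \<in> L" "\<forall>z\<in>L. cinner (x - y') z = 0" for x y y'
  proof -
    have d: "y' - y \<in> L" using y y' L(1) scaleC.subspace_diff by blast
    have "cinner (x - y) (y' - y) = cinner (x - y') (y' - y) + cinner (y' - y) (y' - y)"
      by (simp flip: cinner_add_left)
    then have "cinner (y' - y) (y' - y) = 0" using y y' d by simp
    then show ?thesis by (simp add: cinner_eq_0_iff)
  qed
  show eqI: "orth_proj L x = y" if "y \<in> L" "\<And>z. z \<in> L \<Longrightarrow> cinner (x - y) z = 0" for x y
    unfolding orth_proj_def using that unique by (intro the_equality) blast+
  have ex: "\<exists>y\<in>L. \<forall>z\<in>L. cinner (x - y) z = 0" for x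
  proof -
    obtain y where y: "y \<in> L" "\<And>z. z \<in> L \<Longrightarrow> inner (x - y) z = 0"
      using orthogonal_decomposition[OF sub L(2)] by blast
    have "cinner (x - y) z = 0" if z: "z \<in> L" for z
    proof -
      \<comment> \<open>The real part of the form at \<open>\<i> *\<^sub>C z\<close> is the
        imaginary part of the form at \<open>z\<close>.\<close>
      have "\<i> *\<^sub>C z \<in> L" using L(1) z scaleC.subspace_scale by blast
      from y(2)[OF this] y(2)[OF z] show ?thesis
        by (simp add: inner_eq_Re_cinner cinner_scaleC_right complex_eq_iff)
    qed
    with y(1) show ?thesis by blast
  qed
  show "orth_proj L x \<in> L" for x using ex[of x] eqI by metis
  show "cinner (x - orth_proj L x) z = 0" if "z \<in> L" for x z using ex[of x] eqI that by metis
qed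

text \<open>Linearity comes from the uniqueness of the projection. The bound 1 comes from
  Cauchy-Schwarz, as \<open>x\<close> minus its projection is orthogonal to the projection.\<close>

lemma bounded_clinear_orth_proj:
  fixes L :: "'a::complex_hilbert_space set"
  assumes L: "scaleC.subspace L" "closed L"
  shows "bounded_clinear (orth_proj L)"
proof -
  note [simp] = orth_proj_mem[OF L] orth_proj_orth[OF L]
  have add: "orth_proj L (x + y) = orth_proj L x + orth_proj L y" for x y
  proof (rule orth_proj_eqI[OF L])
    fix z assume "z \<in> L"
    then have "cinner ((x - orth_proj L x) + (y - orth_proj L y)) z = 0"
      by (simp add: cinner_add_left)
    then show "cinner (x + y - (orth_proj L x + orth_proj L y)) z = 0"
      by (simp add: algebra_simps)
  qed (use L in \<open>simp add: scaleC.subspace_add\<close>)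
  have scale: "orth_proj L (c *\<^sub>C x) = c *\<^sub>C orth_proj L x" for c x
  proof (rule orth_proj_eqI[OF L])
    fix z assume "z \<in> L"
    then have "cinner (c *\<^sub>C (x - orth_proj L x)) z = 0"
      by (simp add: cinner_scaleC_left)
    then show "cinner (c *\<^sub>C x - c *\<^sub>C orth_proj L x) z = 0"
      by (simp add: scaleC.scale_right_diff_distrib)
  qed (use L in \<open>simp add: scaleC.subspace_scale\<close>)
  have bound: "norm (orth_proj L x) \<le> norm x" for x
  proof -
    have "inner (x - orth_proj L x) (orth_proj L x) = 0"
      by (simp add: inner_eq_Re_cinner)
    then have "(norm (orth_proj L x))\<^sup>2 = inner x (orth_proj L x)"
      by (simp add: power2_norm_eq_inner inner_diff_left)
    also have "\<dots> \<le> norm x * norm (orth_proj L x)"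
      by (rule norm_cauchy_schwarz)
    finally show ?thesis
      by (cases "orth_proj L x = 0") (simp_all add: power2_eq_square)
  qed
  have "bounded_linear (orth_proj L)"
    by (rule bounded_linear_intro[of _ 1]) (simp_all add: add scale scaleR_scaleC bound)
  then show ?thesis
    by (simp add: bounded_clinear_def scale)
qed

section \<open>Resolvents of quasinilpotent operators and intertwiners\<close>

text \<open>The boundedness hypothesis makes 0 a removable singularity; the resolvent tends to 0 at
  infinity, so Liouville's theorem applies.\<close>

lemma quasinilpotent_resolvent_zero:
  fixes Q :: "'a::complex_hilbert_space \<Rightarrow> 'a" and \<phi> :: "'a \<Rightarrow> complex"
  assumes Q: "bounded_clinear Q"
    and R: "\<And>z. z \<noteq> 0 \<Longrightarrow> bounded_clinear (R z)"
    and left: "\<And>z x. z \<noteq> 0 \<Longrightarrow> R z (Q x - z *\<^sub>C x) = x"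
    and right: "\<And>z x. z \<noteq> 0 \<Longrightarrow> Q (R z x) - z *\<^sub>C R z x = x"
    and \<phi>: "bounded_linear \<phi>" "\<And>c x. \<phi> (c *\<^sub>C x) = c * \<phi> x"
    and near_0: "\<forall>\<^sub>F z in at 0. cmod (\<phi> (R z u)) \<le> M"
    and "z \<noteq> 0"
  shows "\<phi> (R z u) = 0"
proof -
  interpret \<phi>: bounded_linear \<phi> by fact
  have Rlin: "bounded_linear (R z)" and Rscale: "R z (c *\<^sub>C x) = c *\<^sub>C R z x" if "z \<noteq> 0" for z c x
    using R[OF that] by (auto simp: bounded_clinear_def)
  \<comment> \<open>The first resolvent identity, in the sign convention where \<open>R z\<close> is
    the inverse of \<open>Q - z\<close>.\<close>
  have resolvent_id: "R w x - R z x = (w - z) *\<^sub>C R z (R w x)" if "z \<noteq> 0" "w \<noteq> 0" for z w x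
  proof -
    interpret Rz: bounded_linear "R z" using Rlin that(1) .
    have "R w x - R z x = R z ((Q (R w x) - z *\<^sub>C R w x) - (Q (R w x) - w *\<^sub>C R w x))"
      by (simp only: Rz.diff[of "Q (R w x) - z *\<^sub>C R w x"] left[OF that(1)] right[OF that(2)])
    also have "(Q (R w x) - z *\<^sub>C R w x) - (Q (R w x) - w *\<^sub>C R w x) = (w - z) *\<^sub>C R w x"
      by (simp add: scaleC.scale_left_diff_distrib)
    finally show ?thesis using that by (simp add: Rscale)
  qed
  \<comment> \<open>Within distance \<open>1 / (2 * K)\<close> of \<open>z\<close>, the resolvent
    identity bounds the difference by half the norm of \<open>R w x\<close>, so \<open>R w x\<close>
    is at most twice \<open>R z x\<close> in norm. The bound \<open>cmod z\<close> on the distance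
    keeps \<open>w\<close> away from 0, and the added 1 in \<open>K\<close> makes the radius well
    defined.\<close>
  have cont: "((\<lambda>w. R w x) \<longlongrightarrow> R z x) (at z)" if z: "z \<noteq> 0" for z x
  proof -
    define K where "K = onorm (R z) + 1"
    have "K > 0"
      using onorm_pos_le[OF Rlin[OF z]] by (simp add: K_def)
    moreover have "norm (R z y) \<le> K * norm y" for y
      using onorm[OF Rlin[OF z], of y] norm_ge_zero[of y] unfolding K_def distrib_right by linarith
    ultimately have K: "K > 0" "\<And>y. norm (R z y) \<le> K * norm y" by auto
    have "\<forall>\<^sub>F w in at z. dist w z < min (1 / (2 * K)) (cmod z)"
      using K z unfolding eventually_at by (intro exI[of _ "min (1 / (2 * K)) (cmod z)"]) auto
    then have "\<forall>\<^sub>F w in at z. norm (R w x - R z x) \<le> cmod (w - z) * (2 * K * norm (R z x))"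
    proof eventually_elim
      fix w assume w: "dist w z < min (1 / (2 * K)) (cmod z)"
      then have w0: "w \<noteq> 0" by auto
      have d: "norm (R w x - R z x) \<le> cmod (w - z) * (K * norm (R w x))"
        using K by (simp add: resolvent_id[OF z w0] norm_scaleC mult_left_mono)
      have "cmod (w - z) * K \<le> 1 / 2"
        using w K by (simp add: dist_norm field_simps)
      then have "cmod (w - z) * K * norm (R w x) \<le> 1 / 2 * norm (R w x)"
        by (rule mult_right_mono) simp
      moreover have "norm (R w x) \<le> norm (R z x) + norm (R w x - R z x)"
        using norm_triangle_sub by blast
      ultimately have "norm (R w x) \<le> 2 * norm (R z x)"
        using d by (simp add: mult.assoc)
      then have "cmod (w - z) * (K * norm (R w x)) \<le> cmod (w - z) * (K * (2 * norm (R z x)))"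
        using K(1) by (intro mult_left_mono) auto
      with d show "norm (R w x - R z x) \<le> cmod (w - z) * (2 * K * norm (R z x))"
        by (simp add: mult_ac)
    qed
    moreover have "((\<lambda>w. cmod (w - z) * (2 * K * norm (R z x))) \<longlongrightarrow> 0) (at z)"
      by (rule tendsto_eq_intros refl)+ simp
    ultimately have "((\<lambda>w. R w x - R z x) \<longlongrightarrow> 0) (at z)"
      by (rule Lim_null_comparison)
    then show ?thesis by (rule LIM_zero_cancel)
  qed
  have deriv: "((\<lambda>w. \<phi> (R w u)) has_field_derivative \<phi> (R z (R z u))) (at z)" if z: "z \<noteq> 0" for z
  proof -
    have "((\<lambda>w. \<phi> (R w (R z u))) \<longlongrightarrow> \<phi> (R z (R z u))) (at z)"
      by (intro \<phi>.tendsto cont z)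
    \<comment> \<open>The identity is used with \<open>z\<close> and \<open>w\<close> exchanged, so
      that \<open>R w\<close> acts on the fixed vector \<open>R z u\<close>; continuity at that
      single vector then gives the derivative.\<close>
    moreover have "\<forall>\<^sub>F w in at z. \<phi> (R w (R z u)) = (\<phi> (R w u) - \<phi> (R z u)) / (w - z)"
    proof -
      have "\<forall>\<^sub>F w in at z. w \<noteq> 0 \<and> w \<noteq> z"
        using z by (intro eventually_conj eventually_neq_at_within)
      then show ?thesis
      proof eventually_elim
        fix w assume w: "w \<noteq> 0 \<and> w \<noteq> z"
        have "\<phi> (R z u - R w u) = (z - w) * \<phi> (R w (R z u))"
          using w z by (simp add: resolvent_id \<phi>(2))
        then have "\<phi> (R w u) - \<phi> (R z u) = (w - z) * \<phi> (R w (R z u))"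
          unfolding \<phi>.diff by algebra
        then show "\<phi> (R w (R z u)) = (\<phi> (R w u) - \<phi> (R z u)) / (w - z)"
          using w by simp
      qed
    qed
    ultimately show ?thesis
      unfolding has_field_derivative_iff by (rule Lim_transform_eventually)
  qed
  have "(\<lambda>z. \<phi> (R z u)) holomorphic_on UNIV - {0}"
    unfolding holomorphic_on_def field_differentiable_def
    using deriv by (blast intro: has_field_derivative_at_within)
  then obtain g where g: "g holomorphic_on UNIV" "\<And>z. z \<noteq> 0 \<Longrightarrow> g z = \<phi> (R z u)"
    using holomorphic_on_extend_bounded[of "\<lambda>z. \<phi> (R z u)" UNIV 0] near_0 by auto
  \<comment> \<open>From \<open>z *\<^sub>C R z u = Q (R z u) - u\<close>, the norm of
    \<open>R z u\<close> is at most \<open>norm u / (cmod z - K)\<close> once \<open>cmod z\<close>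
    exceeds the norm \<open>K\<close> of \<open>Q\<close>.\<close>
  have "(g \<longlongrightarrow> 0) at_infinity"
  proof (rule Lim_null_comparison)
    define K where "K = onorm Q"
    define C where "C = onorm \<phi>"
    have Qlin: "bounded_linear Q" using Q by (simp add: bounded_clinear_def)
    have C: "0 \<le> C" using onorm_pos_le[OF \<phi>(1)] by (simp add: C_def)
    have K: "0 \<le> K" using onorm_pos_le[OF Qlin] by (simp add: K_def)
    have "\<forall>\<^sub>F z :: complex in at_infinity. K + 1 \<le> norm z"
      unfolding eventually_at_infinity by blast
    then show "\<forall>\<^sub>F z in at_infinity. norm (g z) \<le> C * norm u * norm (inverse (cmod z - K))"
    proof eventually_elim
      fix z :: complex assume z: "K + 1 \<le> norm z"
      then have z0: "z \<noteq> 0" using K by auto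
      have "z *\<^sub>C R z u = Q (R z u) - u"
        using right[OF z0, of u] by (simp add: algebra_simps)
      then have "cmod z * norm (R z u) \<le> norm (Q (R z u)) + norm u"
        using norm_triangle_ineq4 by (metis norm_scaleC)
      also have "norm (Q (R z u)) \<le> K * norm (R z u)"
        unfolding K_def by (rule onorm[OF Qlin])
      finally have "norm (R z u) \<le> norm u * norm (inverse (cmod z - K))"
        using z by (simp add: field_simps)
      moreover have "norm (g z) \<le> C * norm (R z u)"
        unfolding g(2)[OF z0] C_def by (rule onorm[OF \<phi>(1)])
      ultimately show "norm (g z) \<le> C * norm u * norm (inverse (cmod z - K))"
        using C by (smt (verit) mult.assoc mult_left_mono)
    qed
    have "filterlim (\<lambda>z::complex. - K + cmod z) at_top at_infinity"
      by (rule filterlim_tendsto_add_at_top[OF tendsto_const filterlim_norm_at_top])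
    then have "filterlim (\<lambda>z::complex. cmod z - K) at_infinity at_infinity"
      by (intro filterlim_at_top_imp_at_infinity) simp
    then have "((\<lambda>z. inverse (cmod z - K)) \<longlongrightarrow> 0) at_infinity"
      using tendsto_inverse_0 filterlim_compose by blast
    then have "((\<lambda>z. C * norm u * norm (inverse (cmod z - K))) \<longlongrightarrow> C * norm u * norm (0::real)) at_infinity"
      by (intro tendsto_intros)
    then show "((\<lambda>z. C * norm u * norm (inverse (cmod z - K))) \<longlongrightarrow> 0) at_infinity"
      by simp
  qed
  with g(1) have "g z = 0" by (rule Liouville_weak_0)
  with g(2) \<open>z \<noteq> 0\<close> show ?thesis by simp
qed

lemma quasinilpotent_resolvent:
  assumes "quasinilpotent Q"
  obtains R where "\<And>z. z \<noteq> 0 \<Longrightarrow> bounded_clinear (R z)"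
    and "\<And>z x. z \<noteq> 0 \<Longrightarrow> R z (Q x - z *\<^sub>C x) = x"
    and "\<And>z x. z \<noteq> 0 \<Longrightarrow> Q (R z x) - z *\<^sub>C R z x = x"
proof -
  have "\<forall>z\<in>-{0}. \<exists>S. bounded_clinear S \<and> S \<circ> (\<lambda>x. Q x - z *\<^sub>C x) = id
      \<and> (\<lambda>x. Q x - z *\<^sub>C x) \<circ> S = id"
    using assms unfolding quasinilpotent_def op_spectrum_def by blast
  then obtain R where "\<forall>z\<in>-{0}. bounded_clinear (R z) \<and> R z \<circ> (\<lambda>x. Q x - z *\<^sub>C x) = id
      \<and> (\<lambda>x. Q x - z *\<^sub>C x) \<circ> R z = id"
    by metis
  then show thesis
    by (intro that[of R]) (auto simp: fun_eq_iff)
qed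

text \<open>With \<open>K\<close> the norm of \<open>D\<close>, this is the neighbourhood in which a
  term carrying the factor \<open>z D\<close> can be absorbed into the other side of an
  estimate.\<close>

lemma eventually_small_at_0:
  assumes "0 \<le> K"
  shows "\<forall>\<^sub>F z :: complex in at 0. z \<noteq> 0 \<and> cmod z * K \<le> 1 / 2"
proof -
  have "cmod z * K \<le> 1 / 2" if "cmod z < 1 / (2 * (K + 1))" for z
  proof -
    have "cmod z * K \<le> 1 / (2 * (K + 1)) * K"
      using that assms by (intro mult_right_mono) auto
    also have "\<dots> \<le> 1 / 2" using assms by (simp add: field_simps)
    finally show ?thesis .
  qed
  then show ?thesis
    using assms unfolding eventually_at by (intro exI[of _ "1 / (2 * (K + 1))"]) auto
qed

text \<open>Since \<open>Q R = 1 + z R\<close> for the resolvent \<open>R\<close> at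
  \<open>z\<close>, the hypothesis gives \<open>T R = D T + z D T R\<close>. For small
  \<open>z\<close> the last term is absorbed, vector by vector, so \<open>T R\<close> stays bounded
  near 0.\<close>

lemma quasinilpotent_intertwiner_right:
  fixes D Q T :: "'a::complex_hilbert_space \<Rightarrow> 'a"
  assumes D: "bounded_clinear D" and Q: "bounded_clinear Q" "quasinilpotent Q"
    and T: "bounded_clinear T" and DTQ: "\<And>x. D (T (Q x)) = T x"
  shows "T x = 0"
proof -
  obtain R where R: "\<And>z. z \<noteq> 0 \<Longrightarrow> bounded_clinear (R z)"
    and left: "\<And>z x. z \<noteq> 0 \<Longrightarrow> R z (Q x - z *\<^sub>C x) = x"
    and right: "\<And>z x. z \<noteq> 0 \<Longrightarrow> Q (R z x) - z *\<^sub>C R z x = x"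
    using quasinilpotent_resolvent[OF Q(2)] by metis
  have lin: "bounded_linear D" "bounded_linear T"
    and scale: "D (c *\<^sub>C x) = c *\<^sub>C D x" "T (c *\<^sub>C x) = c *\<^sub>C T x" for c x
    using D T by (auto simp: bounded_clinear_def)
  interpret D: bounded_linear D by fact
  interpret T: bounded_linear T by fact
  define K where "K = onorm D"
  have K: "0 \<le> K" using onorm_pos_le[OF lin(1)] by (simp add: K_def)
  \<comment> \<open>The point 1 stands for any nonzero one: the function vanishes at all of
    them.\<close>
  have zero: "cinner (T (R 1 u)) y = 0" for u y
  proof (rule quasinilpotent_resolvent_zero[OF Q(1) R left right, where \<phi> = "\<lambda>v. cinner (T v) y"])
    show "bounded_linear (\<lambda>v. cinner (T v) y)"
      using bounded_linear_cinner_left lin(2) by (rule bounded_linear_compose)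
    show "\<forall>\<^sub>F z in at 0. cmod (cinner (T (R z u)) y) \<le> 2 * norm (D (T u)) * norm y"
      using eventually_small_at_0[OF K]
    proof eventually_elim
      fix z assume z: "z \<noteq> 0 \<and> cmod z * K \<le> 1 / 2"
      have "Q (R z u) = u + z *\<^sub>C R z u"
        using right[of z u] z by (simp add: algebra_simps)
      then have "T (R z u) = D (T u) + z *\<^sub>C D (T (R z u))"
        using DTQ[of "R z u"] by (simp add: D.add T.add scale)
      then have "norm (T (R z u)) \<le> norm (D (T u)) + cmod z * norm (D (T (R z u)))"
        by (metis norm_triangle_ineq norm_scaleC)
      also have "cmod z * norm (D (T (R z u))) \<le> cmod z * (K * norm (T (R z u)))"
        unfolding K_def by (intro mult_left_mono onorm lin) simp
      also have "\<dots> \<le> 1 / 2 * norm (T (R z u))"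
        using z by (simp only: mult.assoc[symmetric]) (intro mult_right_mono, auto)
      finally have "norm (T (R z u)) \<le> 2 * norm (D (T u))" by simp
      then show "cmod (cinner (T (R z u)) y) \<le> 2 * norm (D (T u)) * norm y"
        using cmod_cinner_le order_trans mult_right_mono norm_ge_zero by meson
    qed
  qed (simp_all add: scale cinner_scaleC_left)
  \<comment> \<open>\<open>R 1\<close> is onto: this choice of \<open>u\<close> gives
    \<open>R 1 u = x\<close>, and testing against \<open>T x\<close> itself yields
    \<open>T x = 0\<close>.\<close>
  from zero[of "Q x - 1 *\<^sub>C x" "T x"] show ?thesis
    by (simp only: left[OF one_neq_zero] cinner_eq_0_iff)
qed

text \<open>Here \<open>R T = T D + z R T D\<close>. As \<open>D\<close> acts on the argument, the
  last term involves \<open>R T\<close> at another vector, so the absorption is carried out for the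
  operator norm \<open>N\<close> of \<open>R T\<close>.\<close>

lemma quasinilpotent_intertwiner_left:
  fixes D Q T :: "'a::complex_hilbert_space \<Rightarrow> 'a"
  assumes D: "bounded_clinear D" and Q: "bounded_clinear Q" "quasinilpotent Q"
    and T: "bounded_clinear T" and QTD: "\<And>x. Q (T (D x)) = T x"
  shows "T x = 0"
proof -
  obtain R where R: "\<And>z. z \<noteq> 0 \<Longrightarrow> bounded_clinear (R z)"
    and left: "\<And>z x. z \<noteq> 0 \<Longrightarrow> R z (Q x - z *\<^sub>C x) = x"
    and right: "\<And>z x. z \<noteq> 0 \<Longrightarrow> Q (R z x) - z *\<^sub>C R z x = x"
    using quasinilpotent_resolvent[OF Q(2)] by metis
  have lin: "bounded_linear D" "bounded_linear T"
    using D T by (auto simp: bounded_clinear_def)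
  define K where "K = onorm D"
  define C where "C = onorm (\<lambda>x. T (D x))"
  have linTD: "bounded_linear (\<lambda>x. T (D x))"
    by (rule bounded_linear_compose[OF lin(2) lin(1)])
  have K: "0 \<le> K" using onorm_pos_le[OF lin(1)] by (simp add: K_def)
  have C: "0 \<le> C" using onorm_pos_le[OF linTD] by (simp add: C_def)
  have bound: "norm (R z (T x)) \<le> 2 * C * norm x" if z: "z \<noteq> 0" "cmod z * K \<le> 1 / 2" for z x
  proof -
    have Rlin: "bounded_linear (R z)" and Rscale: "\<And>c x. R z (c *\<^sub>C x) = c *\<^sub>C R z x"
      using R[OF z(1)] by (auto simp: bounded_clinear_def)
    interpret Rz: bounded_linear "R z" by fact
    define N where "N = onorm (\<lambda>x. R z (T x))"
    have linRT: "bounded_linear (\<lambda>x. R z (T x))"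
      using Rlin lin(2) by (rule bounded_linear_compose)
    have N: "0 \<le> N" using onorm_pos_le[OF linRT] by (simp add: N_def)
    have "norm (R z (T v)) \<le> (C + 1 / 2 * N) * norm v" for v
    proof -
      have "R z (T v) = R z (Q (T (D v)) - z *\<^sub>C T (D v)) + z *\<^sub>C R z (T (D v))"
        by (simp add: Rz.diff Rscale QTD)
      then have "R z (T v) = T (D v) + z *\<^sub>C R z (T (D v))"
        by (simp only: left[OF z(1)])
      then have "norm (R z (T v)) \<le> norm (T (D v)) + cmod z * norm (R z (T (D v)))"
        by (metis norm_triangle_ineq norm_scaleC)
      also have "norm (T (D v)) \<le> C * norm v"
        unfolding C_def by (rule onorm[OF linTD])
      also have "cmod z * norm (R z (T (D v))) \<le> cmod z * (N * (K * norm v))"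
      proof (intro mult_left_mono)
        have "norm (R z (T (D v))) \<le> N * norm (D v)"
          unfolding N_def by (rule onorm[OF linRT])
        also have "\<dots> \<le> N * (K * norm v)"
          unfolding K_def by (intro mult_left_mono onorm lin N)
        finally show "norm (R z (T (D v))) \<le> N * (K * norm v)" .
      qed simp
      also have "cmod z * (N * (K * norm v)) = (cmod z * K) * (N * norm v)"
        by (simp add: algebra_simps)
      also have "\<dots> \<le> 1 / 2 * (N * norm v)"
        using z(2) N by (intro mult_right_mono) auto
      finally show ?thesis by (simp add: algebra_simps)
    qed
    \<comment> \<open>\<open>N\<close> is the norm of a bounded operator, hence a genuine upper
      bound, and the inequality can be solved for it.\<close>
    then have "N \<le> C + 1 / 2 * N"
      unfolding N_def using C N by (intro onorm_bound) (auto simp: N_def)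
    then have "N \<le> 2 * C" by simp
    with onorm[OF linRT, of x] show ?thesis
      unfolding N_def[symmetric] using order_trans mult_right_mono norm_ge_zero by meson
  qed
  have "cinner (R 1 (T x)) y = 0" for y
  proof (rule quasinilpotent_resolvent_zero[OF Q(1) R left right, where \<phi> = "\<lambda>v. cinner v y"])
    show "bounded_linear (\<lambda>v. cinner v y)"
      by (rule bounded_linear_cinner_left)
    show "\<forall>\<^sub>F z in at 0. cmod (cinner (R z (T x)) y) \<le> 2 * C * norm x * norm y"
      using eventually_small_at_0[OF K]
    proof eventually_elim
      fix z assume z: "z \<noteq> 0 \<and> cmod z * K \<le> 1 / 2"
      then show "cmod (cinner (R z (T x)) y) \<le> 2 * C * norm x * norm y"
        using bound cmod_cinner_le order_trans mult_right_mono norm_ge_zero by meson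
    qed
  qed (simp_all add: cinner_scaleC_left)
  then have "R 1 (T x) = 0" using cinner_eq_0_iff by blast
  \<comment> \<open>\<open>T x\<close> is recovered by applying \<open>Q - 1\<close> to
    \<open>R 1 (T x)\<close>, which is zero.\<close>
  moreover have "Q 0 = 0"
    using Q(1) unfolding bounded_clinear_def by (metis bounded_linear.linear linear_0)
  ultimately show ?thesis
    using right[of 1 "T x"] by simp
qed

section \<open>Uniqueness of the generalized Drazin inverse\<close>

text \<open>For the idempotents \<open>p = A D\<close> and \<open>q = A E\<close> this says
  \<open>p q = p = q p\<close>. The quasinilpotent remainder is that of \<open>E\<close>; the two
  intertwiner lemmas treat \<open>p (1 - q)\<close> and \<open>(1 - q) p\<close>.\<close>

lemma gen_drazin_idempotent_le:
  assumes A: "bounded_clinear A" and D: "is_gen_drazin_inverse A D" and E: "is_gen_drazin_inverse A E"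
  shows "A (D (A (E x))) = A (D x)" "A (E (A (D x))) = A (D x)"
proof -
  have c: "bounded_clinear A" "bounded_clinear D" "bounded_clinear E"
    and AD: "\<And>x. D (A x) = A (D x)" and DAD: "\<And>x. A (D (D x)) = D x"
    and AE: "\<And>x. E (A x) = A (E x)" and EAE: "\<And>x. A (E (E x)) = E x"
    and quasi: "quasinilpotent (\<lambda>x. A x - A (A (E x)))"
    using assms by (auto simp: is_gen_drazin_inverse_def fun_eq_iff)
  note comp = bounded_clinear_compose
  have sub: "bounded_clinear (\<lambda>x. f x - g x)"
    if "bounded_clinear f" "bounded_clinear g" for f g :: "'a \<Rightarrow> 'a"
    using that by (simp add: bounded_clinear_def bounded_linear_sub scaleC.scale_right_diff_distrib)
  have lin: "linear A" "linear D" "linear E"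
    using c by (auto simp: bounded_clinear_def bounded_linear.linear)
  note diff = lin[THEN linear_diff] lin[THEN linear_0]
  have Q: "bounded_clinear (\<lambda>x. A x - A (A (E x)))"
    by (rule sub[OF c(1) comp[OF c(1) comp[OF c(1) c(3)]]])
  have T: "bounded_clinear (\<lambda>x. A (D x) - A (D (A (E x))))"
    "bounded_clinear (\<lambda>x. A (D x) - A (E (A (D x))))"
    by (rule sub[OF comp[OF c(1) c(2)] comp[OF c(1) comp[OF c(2) comp[OF c(1) c(3)]]]])
      (rule sub[OF comp[OF c(1) c(2)] comp[OF c(1) comp[OF c(3) comp[OF c(1) c(2)]]]])
  have "A (D x) - A (D (A (E x))) = 0"
    by (rule quasinilpotent_intertwiner_right[OF c(2) Q quasi T(1)])
      (simp add: diff AD AE DAD EAE)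
  then show "A (D (A (E x))) = A (D x)" by simp
  have "A (D x) - A (E (A (D x))) = 0"
    by (rule quasinilpotent_intertwiner_left[OF c(2) Q quasi T(2)])
      (simp add: diff AD AE DAD EAE)
  then show "A (E (A (D x))) = A (D x)" by simp
qed

lemma gen_drazin_inverse_unique:
  assumes A: "bounded_clinear A" and D: "is_gen_drazin_inverse A D" and E: "is_gen_drazin_inverse A E"
  shows "D = E"
proof
  fix x
  have AD: "\<And>x. D (A x) = A (D x)" and DAD: "\<And>x. D (A (D x)) = D x"
    and AE: "\<And>x. E (A x) = A (E x)" and EAE: "\<And>x. E (A (E x)) = E x"
    using D E by (auto simp: is_gen_drazin_inverse_def fun_eq_iff)
  \<comment> \<open>Both facts evaluate \<open>p q\<close>: the first as \<open>p\<close>, the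
    second, with \<open>D\<close> and \<open>E\<close> exchanged, as \<open>q\<close>.\<close>
  have p: "A (D x) = A (E x)" for x
    using gen_drazin_idempotent_le(1)[OF A D E] gen_drazin_idempotent_le(2)[OF A E D] by simp
  have "D x = D (A (D x))" by (simp add: DAD)
  also have "\<dots> = A (D (E x))" by (simp only: p[of x] AD)
  also have "\<dots> = E (A (E x))" by (simp only: p AE)
  finally show "D x = E x" by (simp only: EAE)
qed

lemma gen_drazin_inverse_eqI:
  "bounded_clinear A \<Longrightarrow> is_gen_drazin_inverse A D \<Longrightarrow> gen_drazin_inverse A = D"
  unfolding gen_drazin_inverse_def by (blast intro: the_equality gen_drazin_inverse_unique)

section \<open>The core-EP inverse as a product\<close>

text \<open>The range of \<open>D\<close> is the fixed space of the continuous map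
  \<open>A D\<close>, hence closed, so the projection onto it is well behaved. On that range
  \<open>D\<close> inverts \<open>A\<close>, which forces any candidate \<open>B\<close> to be
  \<open>D\<close> after the projection.\<close>

lemma core_EP_inverse_eq:
  assumes A: "bounded_clinear A" and D: "is_gen_drazin_inverse A D"
  shows "core_EP_inverse A = D \<circ> orth_proj (range D)"
    and "x \<in> range D \<Longrightarrow> orth_proj (range D) x = x"
    and "orth_proj (range D) x \<in> range D"
proof -
  have c: "bounded_clinear D" and AD: "\<And>x. D (A x) = A (D x)" and DAD: "\<And>x. D (A (D x)) = D x"
    using D by (auto simp: is_gen_drazin_inverse_def fun_eq_iff)
  have range_iff: "x \<in> range D \<longleftrightarrow> A (D x) = x" for x
    by (metis AD DAD rangeE rangeI)
  have sub: "scaleC.subspace (range D)"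
  proof (rule scaleC.subspaceI)
    show "0 \<in> range D" using c by (metis bounded_clinear_def bounded_linear.linear linear_0 rangeI)
    show "x + y \<in> range D" if "x \<in> range D" "y \<in> range D" for x y
      using that c by (auto simp: bounded_clinear_def simp flip: linear_add[OF bounded_linear.linear])
    show "a *\<^sub>C x \<in> range D" if "x \<in> range D" for a x
      using that c by (auto simp: bounded_clinear_def simp flip: scaleC_scaleC) (metis rangeI)
  qed
  have cont: "continuous_on UNIV (\<lambda>x. A (D x))"
    using bounded_clinear_compose[OF A c]
    by (simp add: bounded_clinear_def linear_continuous_on)
  have "range D = {x. A (D x) = x}"
    by (simp only: set_eq_iff range_iff mem_Collect_eq) simp
  then have closed: "closed (range D)"
    using closed_Collect_eq[OF cont continuous_on_id] by simp
  note P = orth_proj_mem[OF sub closed]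
  show "orth_proj (range D) x = x" if "x \<in> range D" for x
    using that by (intro orth_proj_eqI[OF sub closed]) (simp_all add: cinner_zero_left)
  show "orth_proj (range D) x \<in> range D" for x by (rule P)
  show "core_EP_inverse A = D \<circ> orth_proj (range D)"
    unfolding core_EP_inverse_def gen_drazin_inverse_eqI[OF A D]
  proof (rule the_equality)
    show "bounded_clinear (D \<circ> orth_proj (range D)) \<and>
        A \<circ> (D \<circ> orth_proj (range D)) = orth_proj (range D) \<and>
        range (D \<circ> orth_proj (range D)) \<subseteq> range D"
      using bounded_clinear_compose[OF c bounded_clinear_orth_proj[OF sub closed]] P range_iff
      by (auto simp: o_def fun_eq_iff)
  next
    fix B assume B: "bounded_clinear B \<and> A \<circ> B = orth_proj (range D) \<and> range B \<subseteq> range D"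
    then have "D (A (B x)) = B x" for x
      using range_iff[of "B x"] AD by auto
    with B show "B = D \<circ> orth_proj (range D)"
      by (auto simp: fun_eq_iff)
  qed
qed

section \<open>Characterizations of the weak group inverse\<close>

theorem corollary2p4:
  fixes A B :: "'a::complex_hilbert_space \<Rightarrow> 'a"
  assumes infinite_dim: "\<not> (\<exists>S :: 'a set. finite S \<and> cspan S = UNIV)"
    and A: "bounded_clinear A"
    and gD: "gen_drazin_invertible A"
    and B: "bounded_clinear B"
  shows "(B = weak_group_inverse A \<longleftrightarrow>
           core_EP_inverse A \<circ> A \<circ> B = B \<and> A \<circ> B = core_EP_inverse A \<circ> A)
       \<and> (B = weak_group_inverse A \<longleftrightarrow>
           B \<circ> A \<circ> B = B \<and> A \<circ> B = core_EP_inverse A \<circ> A \<and>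
           B \<circ> core_EP_inverse A = core_EP_inverse A \<circ> core_EP_inverse A)
       \<and> (B = weak_group_inverse A \<longleftrightarrow>
           B \<circ> A \<circ> B = B \<and> A \<circ> B = core_EP_inverse A \<circ> A \<and>
           B \<circ> gen_drazin_inverse A = gen_drazin_inverse A \<circ> gen_drazin_inverse A)"
proof -
  obtain D where D: "is_gen_drazin_inverse A D"
    using gD by (auto simp: gen_drazin_invertible_def)
  define P where "P = orth_proj (range D)"
  define C where "C = core_EP_inverse A"
  have C: "C x = D (P x)" for x
    using core_EP_inverse_eq(1)[OF A D] by (simp add: C_def P_def)
  have AD: "\<And>x. D (A x) = A (D x)" and DAD: "\<And>x. D (A (D x)) = D x"
    using D by (auto simp: is_gen_drazin_inverse_def fun_eq_iff)
  have PD: "P (D x) = D x" for x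
    using core_EP_inverse_eq(2)[OF A D] by (simp add: P_def)
  have ADP: "A (D (P x)) = P x" for x
    using core_EP_inverse_eq(3)[OF A D, of x] AD DAD unfolding P_def by (metis rangeE)
  have AC: "A (C x) = P x" and PC: "P (C x) = C x" and CD: "C (D x) = D (D x)" for x
    by (simp_all add: C ADP PD)
  have CP: "C (P x) = C x" for x
    using core_EP_inverse_eq(2)[OF A D core_EP_inverse_eq(3)[OF A D, of x]] by (simp add: C P_def)
  have DD: "gen_drazin_inverse A = D" by (rule gen_drazin_inverse_eqI[OF A D])
  define W where "W = weak_group_inverse A"
  have W: "W x = C (C (A x))" for x
    by (simp add: W_def C_def weak_group_inverse_def)
  have AW: "A (W x) = C (A x)" and WC: "W (C x) = C (C x)" for x
    by (simp_all add: W AC PC CP)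
  \<comment> \<open>Moving \<open>A\<close> to the right past \<open>D\<close> lets both factors
    \<open>C\<close> act on the range of \<open>D\<close>, where they agree with
    \<open>D\<close>.\<close>
  have WD: "W (D x) = D (D x)" for x
  proof -
    have "W (D x) = D (D (D (A x)))"
      by (simp only: W AD[symmetric] CD)
    then show ?thesis by (simp only: AD[of x] DAD)
  qed
  have "B = W \<longleftrightarrow> C \<circ> A \<circ> B = B \<and> A \<circ> B = C \<circ> A"
  proof
    assume "B = W"
    then show "C \<circ> A \<circ> B = B \<and> A \<circ> B = C \<circ> A"
      by (simp add: fun_eq_iff AW W[symmetric])
  next
    assume "C \<circ> A \<circ> B = B \<and> A \<circ> B = C \<circ> A"
    \<comment> \<open>Substituting the second equation into the first:
      \<open>B = C (A B) = C C A\<close>.\<close>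
    then have "B x = C (C (A x))" for x
      unfolding fun_eq_iff comp_apply by metis
    then show "B = W" by (simp add: fun_eq_iff W)
  qed
  moreover have "B = W \<longleftrightarrow> B \<circ> A \<circ> B = B \<and> A \<circ> B = C \<circ> A \<and> B \<circ> C = C \<circ> C"
  proof
    assume "B = W"
    then show "B \<circ> A \<circ> B = B \<and> A \<circ> B = C \<circ> A \<and> B \<circ> C = C \<circ> C"
      by (simp add: fun_eq_iff AW WC W[symmetric])
  next
    assume "B \<circ> A \<circ> B = B \<and> A \<circ> B = C \<circ> A \<and> B \<circ> C = C \<circ> C"
    \<comment> \<open>Here \<open>B = B (A B) = (B C) A = C C A\<close>.\<close>
    then have "B x = C (C (A x))" for x
      unfolding fun_eq_iff comp_apply by metis
    then show "B = W" by (simp add: fun_eq_iff W)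
  qed
  moreover have "B = W \<longleftrightarrow> B \<circ> A \<circ> B = B \<and> A \<circ> B = C \<circ> A \<and> B \<circ> D = D \<circ> D"
  proof
    assume "B = W"
    then show "B \<circ> A \<circ> B = B \<and> A \<circ> B = C \<circ> A \<and> B \<circ> D = D \<circ> D"
      by (simp add: fun_eq_iff AW WC WD W[symmetric])
  next
    assume "B \<circ> A \<circ> B = B \<and> A \<circ> B = C \<circ> A \<and> B \<circ> D = D \<circ> D"
    then have "B x = B (C (A x))" "B (D y) = D (D y)" for x y
      unfolding fun_eq_iff comp_apply by metis+
    \<comment> \<open>Since \<open>C = D P\<close> maps into the range of \<open>D\<close>, where
      both \<open>B\<close> and \<open>C\<close> act as \<open>D\<close>, it follows that
      \<open>B C = D D P = C C\<close>, as in the previous case.\<close>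
    then have "B x = C (C (A x))" for x
      by (metis C CD)
    then show "B = W" by (simp add: fun_eq_iff W)
  qed
  ultimately show ?thesis
    unfolding DD C_def W_def by blast
qed

end
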